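(* Let $(X,r)$ be a left-non-degenerate (LND) involutive solution. For a map $k\colon X\to X$ define a binary operation $\blacktriangleright_k$ on $X$ by $b\blacktriangleright_k a=\lambda_b k\lambda_b^{-1}(a)$. Then $k\mapsto\ \blacktriangleright_k$ defines an injection $$\operatorname{Refl}_{(X,r)}\hookrightarrow\operatorname{Strange}_X.$$ Moreover, a map $k\colon X\to X$ is a reflection for $(X,r)$ if and only if the operation $\blacktriangleright_k$ is strange.
   Context: For a map $\phi\colon X^m\to X^m$, $\phi_i$ denotes the map on $X^n$ that applies $\phi$ to the $m$ consecutive coordinates starting at position $i$ and is the identity on the others; products of maps denote composition, the rightmost map being applied first. A solution $(X,r)$ is a set $X$ with a map $r\colon X\times X\to X\times X$ satisfying the Yang–Baxter equation $r_1r_2r_1=r_2r_1r_2$ on $X^3$; write $r(a,b)=(\lambda_a(b),\rho_b(a))$. It is left-non-degenerate (LND) if all maps $\lambda_a\colon X\to X$ are bijective, and involutive if $r^2=\mathrm{Id}$. A reflection for $(X,r)$ is a map $k\colon X\to X$ with $r k_2 r k_2=k_2 r k_2 r$ on $X^2$; $\operatorname{Refl}_{(X,r)}$ is the set of all reflections for $(X,r)$. A binary operation $\ast$ on $X$ is strange if $(a\ast b)\ast a=b\ast a$ for all $a,b\in X$; $\operatorname{Strange}_X$ is the set of all strange binary operations on $X$. *)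

theory Defs imports Main begin

fun leg12 :: "('a \<times> 'a \<Rightarrow> 'a \<times> 'a) \<Rightarrow> 'a \<times> 'a \<times> 'a \<Rightarrow> 'a \<times> 'a \<times> 'a" where
  "leg12 r (x, y, z) = (let (u, v) = r (x, y) in (u, v, z))"

fun leg23 :: "('a \<times> 'a \<Rightarrow> 'a \<times> 'a) \<Rightarrow> 'a \<times> 'a \<times> 'a \<Rightarrow> 'a \<times> 'a \<times> 'a" where
  "leg23 r (x, y, z) = (x, r (y, z))"

fun snd_leg :: "('a \<Rightarrow> 'a) \<Rightarrow> 'a \<times> 'a \<Rightarrow> 'a \<times> 'a" where
  "snd_leg k (x, y) = (x, k y)"

text \<open>The underlying set of a solution is the whole type.\<close>

definition solution :: "('a \<times> 'a \<Rightarrow> 'a \<times> 'a) \<Rightarrow> bool" where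
  "solution r \<longleftrightarrow> leg12 r \<circ> leg23 r \<circ> leg12 r = leg23 r \<circ> leg12 r \<circ> leg23 r"

definition lam :: "('a \<times> 'a \<Rightarrow> 'a \<times> 'a) \<Rightarrow> 'a \<Rightarrow> 'a \<Rightarrow> 'a" where
  "lam r a b = fst (r (a, b))"

definition left_non_degenerate :: "('a \<times> 'a \<Rightarrow> 'a \<times> 'a) \<Rightarrow> bool" where
  "left_non_degenerate r \<longleftrightarrow> (\<forall>a. bij (lam r a))"

definition involutive :: "('a \<times> 'a \<Rightarrow> 'a \<times> 'a) \<Rightarrow> bool" where
  "involutive r \<longleftrightarrow> r \<circ> r = id"

definition reflection :: "('a \<times> 'a \<Rightarrow> 'a \<times> 'a) \<Rightarrow> ('a \<Rightarrow> 'a) \<Rightarrow> bool" where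
  "reflection r k \<longleftrightarrow>
     r \<circ> snd_leg k \<circ> r \<circ> snd_leg k = snd_leg k \<circ> r \<circ> snd_leg k \<circ> r"

definition Reflections :: "('a \<times> 'a \<Rightarrow> 'a \<times> 'a) \<Rightarrow> ('a \<Rightarrow> 'a) set" where
  "Reflections r = {k. reflection r k}"

definition strange :: "('a \<Rightarrow> 'a \<Rightarrow> 'a) \<Rightarrow> bool" where
  "strange f \<longleftrightarrow> (\<forall>a b. f (f a b) a = f b a)"

definition Strange :: "('a \<Rightarrow> 'a \<Rightarrow> 'a) set" where
  "Strange = {f. strange f}"

text \<open>The first operand is the index: \<open>refl_op r k b a\<close> is
  \<open>b \<triangleright>\<^sub>k a = \<lambda>\<^sub>b k \<lambda>\<^sub>b\<inverse> a\<close>.\<close>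

definition refl_op :: "('a \<times> 'a \<Rightarrow> 'a \<times> 'a) \<Rightarrow> ('a \<Rightarrow> 'a) \<Rightarrow> 'a \<Rightarrow> 'a \<Rightarrow> 'a" where
  "refl_op r k b a = lam r b (k (inv (lam r b) a))"

end

theory Submission imports Defs begin

text \<open>
  Left non-degeneracy allows the change of coordinates \<open>(a, c) \<mapsto> (a, \<lambda>\<^sub>a\<inverse> c)\<close> on \<open>X\<^sup>2\<close>, a
  bijection. Seen through it, an involutive \<open>r\<close> becomes the flip \<open>(a, c) \<mapsto> (c, a)\<close>, and applying
  \<open>k\<close> to the second entry becomes \<open>(a, c) \<mapsto> (a, a \<triangleright>\<^sub>k c)\<close>. In these coordinates the two sides of
  the reflection equation send \<open>(a, c)\<close> to
  \<open>((a \<triangleright>\<^sub>k c) \<triangleright>\<^sub>k a, a \<triangleright>\<^sub>k c)\<close> and \<open>(c \<triangleright>\<^sub>k a, (c \<triangleright>\<^sub>k a) \<triangleright>\<^sub>k c)\<close>, so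
  the equation consists of the strangeness law for the pair \<open>(a, c)\<close> and for the pair \<open>(c, a)\<close>.
  Finally, \<open>k\<close> is recovered from \<open>\<triangleright>\<^sub>k\<close> by undoing the conjugation with any single \<open>\<lambda>\<^sub>b\<close>.
\<close>

definition chart :: "('a \<times> 'a \<Rightarrow> 'a \<times> 'a) \<Rightarrow> 'a \<Rightarrow> 'a \<Rightarrow> 'a \<times> 'a" where
  "chart r a c = (a, inv (lam r a) c)"

lemma lam_inv_lam:
  assumes "left_non_degenerate r"
  shows "lam r a (inv (lam r a) c) = c"
  using assms by (simp add: left_non_degenerate_def bij_is_surj surj_f_inv_f)

lemma inv_lam_lam:
  assumes "left_non_degenerate r"
  shows "inv (lam r a) (lam r a c) = c"
  using assms by (simp add: left_non_degenerate_def bij_is_inj)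

lemma chart_eq_iff:
  assumes "left_non_degenerate r"
  shows "chart r a c = chart r a' c' \<longleftrightarrow> a = a' \<and> c = c'"
  unfolding chart_def by (metis assms lam_inv_lam prod.inject)

lemma chart_surj:
  assumes "left_non_degenerate r"
  obtains a c where "x = chart r a c"
proof
  show "x = chart r (fst x) (lam r (fst x) (snd x))"
    by (simp add: chart_def inv_lam_lam[OF assms])
qed

text \<open>Writing \<open>r (a, \<lambda>\<^sub>a\<inverse> c) = (c, d)\<close>, involutivity gives \<open>r (c, d) = (a, \<lambda>\<^sub>a\<inverse> c)\<close>, so
  \<open>\<lambda>\<^sub>c d = a\<close> and hence \<open>d = \<lambda>\<^sub>c\<inverse> a\<close>.\<close>

lemma r_chart:
  assumes "left_non_degenerate r" and "involutive r"
  shows "r (chart r a c) = chart r c a"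
proof -
  define d where "d = snd (r (chart r a c))"
  have "fst (r (chart r a c)) = c"
    using lam_inv_lam[OF assms(1), of a c] by (simp add: chart_def lam_def)
  then have rd: "r (chart r a c) = (c, d)"
    by (simp add: d_def prod_eq_iff)
  have "r (r (chart r a c)) = chart r a c"
    using assms(2) by (metis involutive_def comp_apply id_apply)
  then have "lam r c d = a"
    using rd by (simp add: lam_def chart_def)
  then have "d = inv (lam r c) a"
    using inv_lam_lam[OF assms(1), of c d] by simp
  then show ?thesis
    using rd by (simp add: chart_def)
qed

lemma snd_leg_chart:
  assumes "left_non_degenerate r"
  shows "snd_leg k (chart r a c) = chart r a (refl_op r k a c)"
  by (simp add: chart_def refl_op_def inv_lam_lam[OF assms])

theorem reflection_iff_strange:
  assumes "left_non_degenerate r" and "involutive r"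
  shows "reflection r k \<longleftrightarrow> strange (refl_op r k)"
proof -
  let ?f = "refl_op r k"
  have "reflection r k \<longleftrightarrow>
      (\<forall>x. r (snd_leg k (r (snd_leg k x))) = snd_leg k (r (snd_leg k (r x))))"
    by (simp add: reflection_def fun_eq_iff)
  also have "\<dots> \<longleftrightarrow> (\<forall>a c. r (snd_leg k (r (snd_leg k (chart r a c))))
                       = snd_leg k (r (snd_leg k (r (chart r a c)))))"
    by (metis chart_surj[OF assms(1)])
  also have "\<dots> \<longleftrightarrow> (\<forall>a c. ?f (?f a c) a = ?f c a \<and> ?f a c = ?f (?f c a) c)"
    by (simp add: r_chart[OF assms] snd_leg_chart[OF assms(1)] chart_eq_iff[OF assms(1)])
  also have "\<dots> \<longleftrightarrow> strange ?f"
    unfolding strange_def by metis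
  finally show ?thesis .
qed

lemma inj_refl_op:
  assumes "left_non_degenerate r"
  shows "inj (refl_op r)"
proof (rule injI, rule ext)
  fix k k' x
  assume "refl_op r k = refl_op r k'"
  \<comment> \<open>Any index would do; \<open>x\<close> is one that is at hand.\<close>
  then have "refl_op r k x (lam r x x) = refl_op r k' x (lam r x x)"
    by simp
  then have "lam r x (k x) = lam r x (k' x)"
    by (simp add: refl_op_def inv_lam_lam[OF assms])
  then show "k x = k' x"
    by (metis inv_lam_lam[OF assms])
qed

theorem theorem3p10:
  fixes r :: "'a \<times> 'a \<Rightarrow> 'a \<times> 'a"
  assumes "solution r" and "left_non_degenerate r" and "involutive r"
  shows "refl_op r ` Reflections r \<subseteq> Strange \<and> inj_on (refl_op r) (Reflections r) \<and>
         (\<forall>k :: 'a \<Rightarrow> 'a. reflection r k \<longleftrightarrow> strange (refl_op r k))"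
  using reflection_iff_strange[OF assms(2,3)] inj_refl_op[OF assms(2)]
  by (auto simp: Reflections_def Strange_def intro: inj_on_subset)

end
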